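(* Let $\beta=(\beta_n)_{n\in\mathbb{N}}$ be a non-negative increasing stable sequence with $\lim_{n\to\infty}\beta_n=\infty$, and let $K(a_{n,k})$ be a Köthe space. Assume that there exists a non-decreasing function $S:\mathbb{N}\to\mathbb{N}$ such that $$\forall k\in\mathbb{N}\ \exists C>0\ \ \forall n\in\mathbb{N}:\quad e^{k\beta_n}\le C a_{n,S(k)}.$$ Then the family of operators $\hat T_\theta:K(a_{n,k})\to\Lambda_\infty(\beta)$ for $\theta\in\Lambda_\infty(\beta)$, that is, $\hat{\mathcal A}_\infty=\{\hat T_\theta:\theta\in\Lambda_\infty(\beta)\}$, is $\tilde S$-tame, where $\tilde S(k)=S(Mk)$ for every $k\in\mathbb{N}$ and $M=\sup_{n\in\mathbb{N}}\frac{\beta_{2n}}{\beta_n}$.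
   Context: $\mathbb{N}=\{1,2,3,\dots\}$. A Köthe matrix is a matrix $(a_{n,k})_{n,k\in\mathbb{N}}$ of non-negative numbers such that for each $n$ there is $k$ with $a_{n,k}>0$, and $a_{n,k}\le a_{n,k+1}$ for all $n,k$. The Köthe space is $K(a_{n,k})=\{x=(x_n)_{n\in\mathbb{N}}:\|x\|_k:=\sum_n|x_n|a_{n,k}<\infty\ \forall k\in\mathbb{N}\}$, a Fréchet space graded by the seminorms $\|\cdot\|_k$. The sequence $\beta$ is stable if $\sup_{n\in\mathbb{N}}\beta_{2n}/\beta_n<\infty$. The power series space of infinite type $\Lambda_\infty(\beta)$ is the Köthe space with matrix $(e^{k\beta_n})_{n,k}$. $e_n$ is the sequence with $1$ in the $n$-th place and $0$ elsewhere. For a sequence $\theta=(\theta_0,\theta_1,\theta_2,\dots)$ (regarded as an element of a sequence space indexed by $\mathbb{N}$ by letting its $n$-th coordinate be $\theta_{n-1}$), the operator $\hat T_\theta$ given by the lower triangular Toeplitz matrix of $\theta$ is $\hat T_\theta e_n=\sum_{j=n}^\infty\theta_{j-n}e_j$, $\hat T_\theta x=\sum_n x_n\hat T_\theta e_n$ for $x=\sum_n x_ne_n$. Standing assumption: all symbol sequences $\theta$ considered satisfy $\theta_t\ne0$ for infinitely many $t$. $S$-tameness: let $E,F$ be Fréchet spaces graded by increasing seminorms $(\|\cdot\|_k)_{k\in\mathbb{N}}$ and $S:\mathbb{N}\to\mathbb{N}$ non-decreasing. A family $\mathcal A\subseteq L(E,F)$ of continuous linear operators is $S$-tame if for every $T\in\mathcal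 A$ there exist $k_0\in\mathbb{N}$ and $C>0$ such that $\|Tx\|_k\le C\|x\|_{S(k)}$ for all $x\in E$ and all $k\ge k_0$.
   Formalization: In S-tameness the constant C may depend on k (with one C for all k ≥ k_0 the claim is false, e.g. β_n=n, a_{n,k}=e^{kn}, S=id); S(Mk) is read as S(⌈Mk⌉) when Mk is not an integer; the supremum M (and stability) is taken over n with β_n ≠ 0. *)

theory Defs
  imports "HOL-Analysis.Analysis"
begin

text \<open>
  Indices run over the positive integers.  A sequence \<open>(x\<^sub>n)\<close> with \<open>n \<ge> 1\<close> is a function on
  \<^typ>\<open>nat\<close>; membership in a sequence space includes the normalisation \<open>x 0 = 0\<close>, so that
  distinct functions in the space are distinct sequences.  The values of matrices, weights and
  grading indices at \<open>0\<close> are irrelevant.  The scalars are an arbitrary complete real normed field,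
  which covers the real and the complex case.
\<close>

definition kothe_matrix :: "(nat \<Rightarrow> nat \<Rightarrow> real) \<Rightarrow> bool" where
  "kothe_matrix a \<longleftrightarrow>
     (\<forall>n\<ge>1. \<forall>k\<ge>1. 0 \<le> a n k) \<and>
     (\<forall>n\<ge>1. \<exists>k\<ge>1. 0 < a n k) \<and>
     (\<forall>n\<ge>1. \<forall>k\<ge>1. a n k \<le> a n (k + 1))"

definition kothe_space :: "(nat \<Rightarrow> nat \<Rightarrow> real) \<Rightarrow> (nat \<Rightarrow> 'a::{real_normed_field,banach}) set" where
  "kothe_space a = {x. x 0 = 0 \<and> (\<forall>k\<ge>1. (\<lambda>n. norm (x n) * a n k) summable_on {1..})}"

definition kothe_norm :: "(nat \<Rightarrow> nat \<Rightarrow> real) \<Rightarrow> nat \<Rightarrow> (nat \<Rightarrow> 'a::{real_normed_field,banach}) \<Rightarrow> real" where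
  "kothe_norm a k x = (\<Sum>\<^sub>\<infinity>n\<in>{1..}. norm (x n) * a n k)"

definition power_matrix :: "(nat \<Rightarrow> real) \<Rightarrow> nat \<Rightarrow> nat \<Rightarrow> real" where
  "power_matrix \<beta> n k = exp (real k * \<beta> n)"

definition Lambda_inf :: "(nat \<Rightarrow> real) \<Rightarrow> (nat \<Rightarrow> 'a::{real_normed_field,banach}) set" where
  "Lambda_inf \<beta> = kothe_space (power_matrix \<beta>)"

definition Lambda_norm :: "(nat \<Rightarrow> real) \<Rightarrow> nat \<Rightarrow> (nat \<Rightarrow> 'a::{real_normed_field,banach}) \<Rightarrow> real" where
  "Lambda_norm \<beta> = kothe_norm (power_matrix \<beta>)"

text \<open>
  The weights are only non-negative, and finitely many of them may vanish (for instance
  \<open>\<beta>\<^sub>n = ln n\<close>, with \<open>\<beta>\<^sub>1 = 0\<close>), so the quotients \<open>\<beta>\<^sub>2\<^sub>n / \<beta>\<^sub>n\<close> are taken over those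
  \<open>n\<close> for which they are defined.
\<close>

definition stable_seq :: "(nat \<Rightarrow> real) \<Rightarrow> bool" where
  "stable_seq \<beta> \<longleftrightarrow> bdd_above ((\<lambda>n. \<beta> (2 * n) / \<beta> n) ` {n. 1 \<le> n \<and> \<beta> n \<noteq> 0})"

definition stability_const :: "(nat \<Rightarrow> real) \<Rightarrow> real" where
  "stability_const \<beta> = (SUP n\<in>{n. 1 \<le> n \<and> \<beta> n \<noteq> 0}. \<beta> (2 * n) / \<beta> n)"

text \<open>
  The map \<open>k \<mapsto> S (M k)\<close>, where \<open>M\<close> is the stability constant.  Since \<open>M k\<close> need not be an
  integer, it is rounded up.
\<close>

definition stretched_index_map :: "(nat \<Rightarrow> real) \<Rightarrow> (nat \<Rightarrow> nat) \<Rightarrow> nat \<Rightarrow> nat" where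
  "stretched_index_map \<beta> S k = S (nat \<lceil>stability_const \<beta> * real k\<rceil>)"

definition graded_topology ::
    "(nat \<Rightarrow> 'a::{real_normed_field,banach}) set \<Rightarrow> (nat \<Rightarrow> (nat \<Rightarrow> 'a) \<Rightarrow> real) \<Rightarrow> (nat \<Rightarrow> 'a) topology" where
  "graded_topology E p = topology_generated_by
     {{y \<in> E. p k (\<lambda>i. y i - x i) < \<epsilon>} | x k \<epsilon>. x \<in> E \<and> 1 \<le> k \<and> 0 < \<epsilon>}"

text \<open>Linear maps that are continuous between the graded spaces; values outside \<open>E\<close> are irrelevant.\<close>

definition continuous_linear_ops ::
    "(nat \<Rightarrow> 'a::{real_normed_field,banach}) set \<Rightarrow> (nat \<Rightarrow> (nat \<Rightarrow> 'a) \<Rightarrow> real) \<Rightarrow>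
     (nat \<Rightarrow> 'a) set \<Rightarrow> (nat \<Rightarrow> (nat \<Rightarrow> 'a) \<Rightarrow> real) \<Rightarrow> ((nat \<Rightarrow> 'a) \<Rightarrow> (nat \<Rightarrow> 'a)) set" where
  "continuous_linear_ops E p F q = {T.
     (\<forall>x\<in>E. T x \<in> F) \<and>
     (\<forall>x\<in>E. \<forall>y\<in>E. T (\<lambda>i. x i + y i) = (\<lambda>i. T x i + T y i)) \<and>
     (\<forall>c. \<forall>x\<in>E. T (\<lambda>i. c * x i) = (\<lambda>i. c * T x i)) \<and>
     continuous_map (graded_topology E p) (graded_topology F q) T}"

definition nondecreasing_index_map :: "(nat \<Rightarrow> nat) \<Rightarrow> bool" where
  "nondecreasing_index_map S \<longleftrightarrow> (\<forall>k\<ge>1. 1 \<le> S k) \<and> mono_on {1..} S"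

text \<open>
  The constant \<open>C\<close> is allowed to depend on \<open>k\<close>, as is usual for tameness.  A single \<open>C\<close> for
  all \<open>k\<close> would not be a meaningful notion for the operators below: for \<open>a = power_matrix \<beta>\<close>,
  any symbol \<open>\<theta>\<close> with infinitely many non-zero terms and any \<open>m\<close>, the norm
  \<open>\<Sum>\<^sub>i |\<theta>\<^sub>i| exp (k \<beta>\<^sub>1\<^sub>+\<^sub>i)\<close> of the image of the first unit sequence is not bounded by a
  constant multiple of \<open>exp (m k \<beta>\<^sub>1)\<close> for all large \<open>k\<close>.
\<close>

definition S_tame ::
    "(nat \<Rightarrow> nat) \<Rightarrow>
     (nat \<Rightarrow> 'a::{real_normed_field,banach}) set \<Rightarrow> (nat \<Rightarrow> (nat \<Rightarrow> 'a) \<Rightarrow> real) \<Rightarrow>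
     (nat \<Rightarrow> 'a) set \<Rightarrow> (nat \<Rightarrow> (nat \<Rightarrow> 'a) \<Rightarrow> real) \<Rightarrow>
     ((nat \<Rightarrow> 'a) \<Rightarrow> (nat \<Rightarrow> 'a)) set \<Rightarrow> bool" where
  "S_tame S E p F q A \<longleftrightarrow>
     nondecreasing_index_map S \<and>
     A \<subseteq> continuous_linear_ops E p F q \<and>
     (\<forall>T\<in>A. \<exists>k0\<ge>1. \<forall>k\<ge>k0. \<exists>C>0. \<forall>x\<in>E. q k (T x) \<le> C * p (S k) x)"

definition unit_seq :: "nat \<Rightarrow> nat \<Rightarrow> 'a::{real_normed_field,banach}" where
  "unit_seq n = (\<lambda>i. if i = n then 1 else 0)"

text \<open>The sum, in the topology of the graded space, of the series of the \<open>f n\<close> with \<open>n \<ge> m\<close>.\<close>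

definition series_limit ::
    "(nat \<Rightarrow> 'a::{real_normed_field,banach}) set \<Rightarrow> (nat \<Rightarrow> (nat \<Rightarrow> 'a) \<Rightarrow> real) \<Rightarrow>
     nat \<Rightarrow> (nat \<Rightarrow> nat \<Rightarrow> 'a) \<Rightarrow> (nat \<Rightarrow> 'a)" where
  "series_limit F q m f =
     (THE y. limitin (graded_topology F q) (\<lambda>N i. \<Sum>n=m..N. f n i) y sequentially)"

definition toeplitz_column ::
    "(nat \<Rightarrow> real) \<Rightarrow> (nat \<Rightarrow> 'a::{real_normed_field,banach}) \<Rightarrow> nat \<Rightarrow> (nat \<Rightarrow> 'a)" where
  "toeplitz_column \<beta> \<theta> n =
     series_limit (Lambda_inf \<beta>) (Lambda_norm \<beta>) n (\<lambda>j i. \<theta> (j - n) * unit_seq j i)"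

definition toeplitz_op ::
    "(nat \<Rightarrow> real) \<Rightarrow> (nat \<Rightarrow> 'a::{real_normed_field,banach}) \<Rightarrow> (nat \<Rightarrow> 'a) \<Rightarrow> (nat \<Rightarrow> 'a)" where
  "toeplitz_op \<beta> \<theta> x =
     series_limit (Lambda_inf \<beta>) (Lambda_norm \<beta>) 1 (\<lambda>n i. x n * toeplitz_column \<beta> \<theta> n i)"

text \<open>
  A symbol \<open>\<theta>\<close> is indexed from \<open>0\<close>; as a sequence indexed from \<open>1\<close> its \<open>n\<close>-th coordinate is
  \<open>\<theta> (n - 1)\<close>.
\<close>

definition symbol_seq :: "(nat \<Rightarrow> 'a::{real_normed_field,banach}) \<Rightarrow> (nat \<Rightarrow> 'a)" where
  "symbol_seq \<theta> = (\<lambda>n. if n = 0 then 0 else \<theta> (n - 1))"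

definition toeplitz_family ::
    "(nat \<Rightarrow> real) \<Rightarrow> ((nat \<Rightarrow> 'a::{real_normed_field,banach}) \<Rightarrow> (nat \<Rightarrow> 'a)) set" where
  "toeplitz_family \<beta> =
     {toeplitz_op \<beta> \<theta> | \<theta>. symbol_seq \<theta> \<in> Lambda_inf \<beta> \<and> infinite {t. \<theta> t \<noteq> 0}}"

end

theory Submission
  imports Defs
begin

text \<open>
  Stability makes the exponents subadditive up to the factor \<open>M\<close> and an additive constant.  If
  \<open>i = n + m - 1\<close>, then \<open>i \<le> 2 max n m\<close>, so by monotonicity
  \<open>\<beta>\<^sub>i \<le> M \<beta>\<^bsub>max n m\<^esub> + B \<le> M (\<beta>\<^sub>n + \<beta>\<^sub>m) + B\<close>, where \<open>B\<close> absorbs the finitely many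
  indices at which \<open>\<beta>\<close> vanishes.  With \<open>l = \<lceil>M k\<rceil>\<close> this reads
  \<open>e\<^bsup>k \<beta>\<^sub>i\<^esup> \<le> D e\<^bsup>l \<beta>\<^sub>n\<^esup> e\<^bsup>l \<beta>\<^sub>m\<^esup>\<close>: the \<open>k\<close>-th weight is submultiplicative, up to a constant,
  with respect to the \<open>l\<close>-th one (\<open>power_matrix_quasi_submultiplicative\<close>).

  The operator with symbol \<open>\<theta>\<close> is convolution with \<open>\<theta>\<close>, so Young's inequality in weighted
  \<open>\<ell>\<^sub>1\<close> bounds the \<open>k\<close>-th norm of the image of \<open>x\<close> by \<open>D (\<Sum>\<^sub>n \<bar>x\<^sub>n\<bar> e\<^bsup>l \<beta>\<^sub>n\<^esup>) \<parallel>\<theta>\<parallel>\<^sub>l\<close>, and the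
  hypothesis on \<open>S\<close> bounds the sum over \<open>n\<close> by a multiple of \<open>\<parallel>x\<parallel>\<close> in the grading \<open>S l\<close>
  (\<open>toeplitz_conv_bound\<close>, \<open>toeplitz_conv_tame\<close>).  This holds for every \<open>k \<ge> 1\<close>, and it also gives
  continuity.

  It remains to see that the operator, which is a limit of a series of columns that are themselves
  limits of series, is this convolution.  Truncations converge in every Koethe space.  The partial
  sums of a column are truncations of the expected column, and the partial sums of the operator
  series at \<open>x\<close> are convolutions with truncations of \<open>x\<close>, which converge by the same norm
  estimate.  Koethe spaces are Hausdorff, so the limits are unique (\<open>series_limit_kothe_eqI\<close>,
  \<open>toeplitz_op_eq_conv\<close>).
\<close>

section \<open>Koethe spaces and their graded topology\<close>

lemma kothe_matrix_nonneg: "kothe_matrix a \<Longrightarrow> 1 \<le> n \<Longrightarrow> 1 \<le> k \<Longrightarrow> 0 \<le> a n k"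
  by (simp add: kothe_matrix_def)

lemma kothe_matrix_power_matrix:
  assumes "\<forall>n\<ge>1. 0 \<le> \<beta> n"
  shows "kothe_matrix (power_matrix \<beta>)"
  unfolding kothe_matrix_def power_matrix_def using assms
  by (auto intro!: mult_right_mono exI[of _ 1])

lemma kothe_space_summable:
  "x \<in> kothe_space a \<Longrightarrow> 1 \<le> k \<Longrightarrow> (\<lambda>n. norm (x n) * a n k) summable_on {1..}"
  by (simp add: kothe_space_def)

lemma kothe_norm_nonneg: "kothe_matrix a \<Longrightarrow> 1 \<le> k \<Longrightarrow> 0 \<le> kothe_norm a k x"
  unfolding kothe_norm_def
  by (rule infsum_nonneg) (auto intro!: mult_nonneg_nonneg dest: kothe_matrix_nonneg)

lemma kothe_space_dominated:
  fixes x y :: "nat \<Rightarrow> 'a::{real_normed_field,banach}"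
  assumes "kothe_matrix a" "x \<in> kothe_space a" "y 0 = 0" "\<And>n. 1 \<le> n \<Longrightarrow> norm (y n) \<le> norm (x n)"
  shows "y \<in> kothe_space a"
  unfolding kothe_space_def
proof (intro CollectI conjI allI impI)
  fix k :: nat assume k: "1 \<le> k"
  show "(\<lambda>n. norm (y n) * a n k) summable_on {1..}"
    by (rule summable_on_comparison_test[OF kothe_space_summable[OF assms(2) k]])
       (use assms k in \<open>auto intro!: mult_right_mono dest: kothe_matrix_nonneg
          simp: abs_mult kothe_matrix_nonneg\<close>)
qed (fact assms(3))

lemma kothe_triangle:
  fixes x y :: "nat \<Rightarrow> 'a::{real_normed_field,banach}"
  assumes a: "kothe_matrix a" and x: "x \<in> kothe_space a" and y: "y \<in> kothe_space a"
  shows kothe_space_add: "(\<lambda>i. x i + y i) \<in> kothe_space a"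
    and kothe_norm_triangle:
      "1 \<le> k \<Longrightarrow> kothe_norm a k (\<lambda>i. x i + y i) \<le> kothe_norm a k x + kothe_norm a k y"
proof -
  have summ: "(\<lambda>n. norm (x n) * a n k + norm (y n) * a n k) summable_on {1..}" if "1 \<le> k" for k
    by (intro summable_on_add kothe_space_summable[OF x that] kothe_space_summable[OF y that])
  have le: "norm (x n + y n) * a n k \<le> norm (x n) * a n k + norm (y n) * a n k"
    if "1 \<le> k" "n \<in> {1..}" for k n
    using mult_right_mono[OF norm_triangle_ineq[of "x n" "y n"] kothe_matrix_nonneg[OF a, of n k]] that
    by (simp add: distrib_right)
  have summ': "(\<lambda>n. norm (x n + y n) * a n k) summable_on {1..}" if k: "1 \<le> k" for k
    by (rule summable_on_comparison_test[OF summ[OF k]])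
       (use le[OF k] a k in \<open>auto simp: abs_mult kothe_matrix_nonneg\<close>)
  show "(\<lambda>i. x i + y i) \<in> kothe_space a"
    using x y summ' by (auto simp: kothe_space_def)
  show "kothe_norm a k (\<lambda>i. x i + y i) \<le> kothe_norm a k x + kothe_norm a k y" if k: "1 \<le> k"
    unfolding kothe_norm_def
      infsum_add[OF kothe_space_summable[OF x k] kothe_space_summable[OF y k], symmetric]
    by (rule infsum_mono[OF summ'[OF k] summ[OF k] le[OF k]])
qed

lemma kothe_space_uminus:
  "x \<in> kothe_space a \<Longrightarrow> (\<lambda>i. - x i) \<in> kothe_space a"
  by (simp add: kothe_space_def)

lemma kothe_space_diff:
  assumes "kothe_matrix a" "x \<in> kothe_space a" "y \<in> kothe_space a"
  shows "(\<lambda>i. x i - y i) \<in> kothe_space a"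
  using kothe_space_add[OF assms(1,2) kothe_space_uminus[OF assms(3)]] by simp

lemma kothe_norm_minus_commute: "kothe_norm a k (\<lambda>i. x i - y i) = kothe_norm a k (\<lambda>i. y i - x i)"
  by (simp add: kothe_norm_def norm_minus_commute)

lemma kothe_norm_diff_triangle:
  fixes x y z :: "nat \<Rightarrow> 'a::{real_normed_field,banach}"
  assumes "kothe_matrix a" "x \<in> kothe_space a" "y \<in> kothe_space a" "z \<in> kothe_space a" "1 \<le> k"
  shows "kothe_norm a k (\<lambda>i. x i - z i)
           \<le> kothe_norm a k (\<lambda>i. x i - y i) + kothe_norm a k (\<lambda>i. y i - z i)"
  using kothe_norm_triangle[OF assms(1) kothe_space_diff[OF assms(1-3)]
      kothe_space_diff[OF assms(1,3,4)] assms(5)]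
  by simp

text \<open>Every coordinate is controlled by some seminorm, since every row of a Koethe matrix has a
  positive entry.\<close>

lemma kothe_norm_eq_0_imp_eq:
  fixes x y :: "nat \<Rightarrow> 'a::{real_normed_field,banach}"
  assumes a: "kothe_matrix a" and x: "x \<in> kothe_space a" and y: "y \<in> kothe_space a"
    and 0: "\<And>k. 1 \<le> k \<Longrightarrow> kothe_norm a k (\<lambda>i. x i - y i) \<le> 0"
  shows "x = y"
proof
  fix n
  show "x n = y n"
  proof (cases "n = 0")
    case True then show ?thesis using x y by (simp add: kothe_space_def)
  next
    case False
    then have "1 \<le> n" by simp
    then obtain k where k: "1 \<le> k" "0 < a n k" using a unfolding kothe_matrix_def by blast
    have s: "(\<lambda>n. norm (x n - y n) * a n k) summable_on {1..}"
      using kothe_space_summable[OF kothe_space_diff[OF a x y] k(1)] .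
    have "norm (x n - y n) * a n k = 0"
      using 0[OF k(1)] s False k(1) unfolding kothe_norm_def
      by (intro nonneg_infsum_le_0D[where A="{1..}"]) (auto simp: kothe_matrix_nonneg[OF a])
    then show ?thesis using k(2) by simp
  qed
qed

lemma openin_graded_ball:
  "x \<in> E \<Longrightarrow> 1 \<le> k \<Longrightarrow> 0 < \<epsilon> \<Longrightarrow> openin (graded_topology E p) {y \<in> E. p k (\<lambda>i. y i - x i) < \<epsilon>}"
  unfolding graded_topology_def by (rule topology_generated_by_Basis) blast

lemma topspace_graded_kothe:
  "topspace (graded_topology (kothe_space a) (kothe_norm a))
     = (kothe_space a :: (nat \<Rightarrow> 'a::{real_normed_field,banach}) set)" (is "topspace ?X = ?E")
proof
  show "topspace ?X \<subseteq> ?E"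
    unfolding graded_topology_def topology_generated_by_topspace by blast
  show "?E \<subseteq> topspace ?X"
  proof
    fix x assume x: "x \<in> ?E"
    then have "x \<in> {y \<in> ?E. kothe_norm a 1 (\<lambda>i. y i - x i) < 1}"
      by (simp add: kothe_norm_def)
    then show "x \<in> topspace ?X"
      using openin_subset[OF openin_graded_ball[OF x, of 1 1 "kothe_norm a"]] by auto
  qed
qed

text \<open>It suffices to check neighbourhoods from the generating family of balls.  Their centres need not
  be the limit, hence the triangle inequality.\<close>

lemma limitin_graded_kothe:
  fixes s :: "nat \<Rightarrow> nat \<Rightarrow> 'a::{real_normed_field,banach}"
  assumes a: "kothe_matrix a"
    and s: "\<And>N. s N \<in> kothe_space a" and y: "y \<in> kothe_space a"
    and lim: "\<And>k. 1 \<le> k \<Longrightarrow> (\<lambda>N. kothe_norm a k (\<lambda>i. s N i - y i)) \<longlonglongrightarrow> 0"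
  shows "limitin (graded_topology (kothe_space a) (kothe_norm a)) s y sequentially"
  unfolding limitin_def topspace_graded_kothe
proof (intro conjI allI impI y)
  fix U assume "openin (graded_topology (kothe_space a) (kothe_norm a)) U \<and> y \<in> U"
  then have U: "generate_topology_on {{y \<in> kothe_space a. kothe_norm a k (\<lambda>i. y i - x i) < \<epsilon>} | x k \<epsilon>.
      x \<in> kothe_space a \<and> 1 \<le> k \<and> 0 < \<epsilon>} U" and "y \<in> U"
    by (auto simp: graded_topology_def openin_topology_generated_by_iff)
  then show "\<forall>\<^sub>F N in sequentially. s N \<in> U"
  proof (induction rule: generate_topology_on.induct)
    case (Int A B)
    then show ?case by (auto intro: eventually_conj)
  next
    case (UN K)
    then obtain V where "V \<in> K" "\<forall>\<^sub>F N in sequentially. s N \<in> V" by auto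
    then show ?case by (auto elim!: eventually_mono)
  next
    case (Basis V)
    then obtain x k \<epsilon> where V: "V = {y \<in> kothe_space a. kothe_norm a k (\<lambda>i. y i - x i) < \<epsilon>}"
      and x: "x \<in> kothe_space a" and k: "1 \<le> k" by auto
    have "\<forall>\<^sub>F N in sequentially. kothe_norm a k (\<lambda>i. s N i - y i) < \<epsilon> - kothe_norm a k (\<lambda>i. y i - x i)"
      using Basis.prems by (intro order_tendstoD(2)[OF lim[OF k]]) (simp add: V)
    then show ?case
    proof (rule eventually_mono)
      fix N assume "kothe_norm a k (\<lambda>i. s N i - y i) < \<epsilon> - kothe_norm a k (\<lambda>i. y i - x i)"
      then show "s N \<in> V"
        using kothe_norm_diff_triangle[OF a s y x k, of N] s by (simp add: V)
    qed
  qed simp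
qed

lemma kothe_norm_tendsto_0_of_limitin:
  fixes s :: "nat \<Rightarrow> nat \<Rightarrow> 'a::{real_normed_field,banach}"
  assumes a: "kothe_matrix a" and k: "1 \<le> k"
    and lim: "limitin (graded_topology (kothe_space a) (kothe_norm a)) s y sequentially"
  shows "(\<lambda>N. kothe_norm a k (\<lambda>i. s N i - y i)) \<longlonglongrightarrow> 0"
proof (rule order_tendstoI)
  have y: "y \<in> kothe_space a"
    using limitin_topspace[OF lim] by (simp add: topspace_graded_kothe)
  fix \<epsilon> :: real assume \<epsilon>: "0 < \<epsilon>"
  have "y \<in> {z \<in> kothe_space a. kothe_norm a k (\<lambda>i. z i - y i) < \<epsilon>}"
    using y \<epsilon> by (simp add: kothe_norm_def)
  with openin_graded_ball[OF y k \<epsilon>] lim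
  have "\<forall>\<^sub>F N in sequentially. s N \<in> {z \<in> kothe_space a. kothe_norm a k (\<lambda>i. z i - y i) < \<epsilon>}"
    unfolding limitin_def by blast
  then show "\<forall>\<^sub>F N in sequentially. kothe_norm a k (\<lambda>i. s N i - y i) < \<epsilon>"
    by (auto elim: eventually_mono)
next
  fix \<epsilon> :: real assume "\<epsilon> < 0"
  then have "\<epsilon> < kothe_norm a k (\<lambda>i. s N i - y i)" for N
    using kothe_norm_nonneg[OF a k] by (rule less_le_trans)
  then show "\<forall>\<^sub>F N in sequentially. \<epsilon> < kothe_norm a k (\<lambda>i. s N i - y i)" by simp
qed

text \<open>Since Koethe spaces are Hausdorff, a limit found in the seminorms is the limit that
  \<^const>\<open>series_limit\<close> selects.\<close>

lemma series_limit_kothe_eqI: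
  fixes f :: "nat \<Rightarrow> nat \<Rightarrow> 'a::{real_normed_field,banach}"
  assumes a: "kothe_matrix a"
    and s: "\<And>N. (\<lambda>i. \<Sum>n=m..N. f n i) \<in> kothe_space a" and y: "y \<in> kothe_space a"
    and lim: "\<And>k. 1 \<le> k \<Longrightarrow> (\<lambda>N. kothe_norm a k (\<lambda>i. (\<Sum>n=m..N. f n i) - y i)) \<longlonglongrightarrow> 0"
  shows "series_limit (kothe_space a) (kothe_norm a) m f = y"
  unfolding series_limit_def
proof (rule the_equality)
  show "limitin (graded_topology (kothe_space a) (kothe_norm a)) (\<lambda>N i. \<Sum>n=m..N. f n i) y sequentially"
    by (rule limitin_graded_kothe[OF a s y lim])
next
  fix z
  assume z: "limitin (graded_topology (kothe_space a) (kothe_norm a)) (\<lambda>N i. \<Sum>n=m..N. f n i) z sequentially"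
  then have zE: "z \<in> kothe_space a"
    using limitin_topspace by (fastforce simp: topspace_graded_kothe)
  show "z = y"
  proof (rule kothe_norm_eq_0_imp_eq[OF a zE y])
    fix k :: nat assume k: "1 \<le> k"
    have "(\<lambda>N. kothe_norm a k (\<lambda>i. (\<Sum>n=m..N. f n i) - z i)
             + kothe_norm a k (\<lambda>i. (\<Sum>n=m..N. f n i) - y i)) \<longlonglongrightarrow> 0"
      using tendsto_add[OF kothe_norm_tendsto_0_of_limitin[OF a k z] lim[OF k]] by simp
    then show "kothe_norm a k (\<lambda>i. z i - y i) \<le> 0"
    proof (rule tendsto_lowerbound)
      show "\<forall>\<^sub>F N in sequentially. kothe_norm a k (\<lambda>i. z i - y i)
              \<le> kothe_norm a k (\<lambda>i. (\<Sum>n=m..N. f n i) - z i)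
                 + kothe_norm a k (\<lambda>i. (\<Sum>n=m..N. f n i) - y i)"
        using kothe_norm_diff_triangle[OF a zE s y k] kothe_norm_minus_commute[of a k z]
        by (intro always_eventually) simp
    qed simp
  qed
qed

definition truncate_seq :: "nat \<Rightarrow> (nat \<Rightarrow> 'a::zero) \<Rightarrow> nat \<Rightarrow> 'a" where
  "truncate_seq N x = (\<lambda>n. if n \<le> N then x n else 0)"

lemma truncate_seq_in_kothe_space:
  "kothe_matrix a \<Longrightarrow> x \<in> kothe_space a \<Longrightarrow> truncate_seq N x \<in> kothe_space a"
  by (erule kothe_space_dominated[where x=x]) (auto simp: truncate_seq_def kothe_space_def)

text \<open>The norm of the truncation error is a tail of the convergent series defining the norm of
  \<open>x\<close>.\<close>

lemma truncate_seq_tendsto: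
  fixes x :: "nat \<Rightarrow> 'a::{real_normed_field,banach}"
  assumes a: "kothe_matrix a" and x: "x \<in> kothe_space a" and k: "1 \<le> k"
  shows "(\<lambda>N. kothe_norm a k (\<lambda>i. truncate_seq N x i - x i)) \<longlonglongrightarrow> 0"
proof -
  define f where "f n = norm (x n) * a n k" for n
  have f: "f summable_on {1..}"
    unfolding f_def by (rule kothe_space_summable[OF x k])
  have "filterlim (\<lambda>N. {1..N::nat}) (finite_subsets_at_top {1..}) sequentially"
    unfolding filterlim_finite_subsets_at_top
  proof (intro allI impI)
    fix X :: "nat set" assume X: "finite X \<and> X \<subseteq> {1..}"
    show "\<forall>\<^sub>F N in sequentially. finite {1..N} \<and> X \<subseteq> {1..N} \<and> {1..N} \<subseteq> {1..}"
      using X by (intro eventually_sequentiallyI[of "Max (insert 0 X)"]) auto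
  qed
  with infsum_tendsto[OF f] have "(\<lambda>N. sum f {1..N}) \<longlonglongrightarrow> infsum f {1..}"
    by (rule filterlim_compose)
  then have "(\<lambda>N. infsum f {1..} - sum f {1..N}) \<longlonglongrightarrow> 0"
    using tendsto_diff[OF tendsto_const, of _ _ sequentially "infsum f {1..}"] by fastforce
  moreover have "kothe_norm a k (\<lambda>i. truncate_seq N x i - x i) = infsum f {1..} - sum f {1..N}" for N
  proof -
    have "kothe_norm a k (\<lambda>i. truncate_seq N x i - x i) = infsum f ({1..} - {1..N})"
      unfolding kothe_norm_def f_def truncate_seq_def
      by (rule infsum_cong_neutral) auto
    also have "\<dots> = infsum f {1..} - infsum f {1..N}"
      using f by (intro infsum_Diff) auto
    finally show ?thesis by simp
  qed
  ultimately show ?thesis by simp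
qed

text \<open>By linearity, the image of the ball of radius \<open>\<delta>\<close> around \<open>x\<close> stays within \<open>C \<delta>\<close> of \<open>T x\<close>, so a
  ball around \<open>x\<close> fits into the preimage of each generating ball around any centre.\<close>

lemma continuous_linear_opI:
  fixes T :: "(nat \<Rightarrow> 'a::{real_normed_field,banach}) \<Rightarrow> nat \<Rightarrow> 'a"
  assumes a: "kothe_matrix a" and b: "kothe_matrix b"
    and maps: "\<And>x. x \<in> kothe_space a \<Longrightarrow> T x \<in> kothe_space b"
    and add: "\<And>x y. x \<in> kothe_space a \<Longrightarrow> y \<in> kothe_space a \<Longrightarrow>
                T (\<lambda>i. x i + y i) = (\<lambda>i. T x i + T y i)"
    and scale: "\<And>c x. x \<in> kothe_space a \<Longrightarrow> T (\<lambda>i. c * x i) = (\<lambda>i. c * T x i)"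
    and bound: "\<And>k. 1 \<le> k \<Longrightarrow> \<exists>l\<ge>1. \<exists>C>0. \<forall>x\<in>kothe_space a. kothe_norm b k (T x) \<le> C * kothe_norm a l x"
  shows "T \<in> continuous_linear_ops (kothe_space a) (kothe_norm a) (kothe_space b) (kothe_norm b)"
proof -
  let ?E = "kothe_space a :: (nat \<Rightarrow> 'a) set"
  let ?X = "graded_topology ?E (kothe_norm a)"
  have diff: "T (\<lambda>i. x i - y i) = (\<lambda>i. T x i - T y i)" if "x \<in> ?E" "y \<in> ?E" for x y
    using add[OF that(1) kothe_space_uminus[OF that(2)]] scale[OF that(2), of "-1"] by simp
  have "continuous_map ?X (graded_topology (kothe_space b) (kothe_norm b)) T"
    unfolding graded_topology_def[of "kothe_space b"] continuous_on_generated_topo_iff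
  proof (intro conjI allI impI)
    fix U :: "(nat \<Rightarrow> 'a) set"
    assume "U \<in> {{y \<in> kothe_space b. kothe_norm b k (\<lambda>i. y i - x i) < \<epsilon>} |x k \<epsilon>.
                 x \<in> kothe_space b \<and> 1 \<le> k \<and> 0 < \<epsilon>}"
    then obtain z k \<epsilon> where U: "U = {y \<in> kothe_space b. kothe_norm b k (\<lambda>i. y i - z i) < \<epsilon>}"
      and z: "z \<in> kothe_space b" and k: "1 \<le> k" by blast
    obtain l C where l: "1 \<le> l" and C: "0 < C"
      and le: "\<And>x. x \<in> ?E \<Longrightarrow> kothe_norm b k (T x) \<le> C * kothe_norm a l x"
      using bound[OF k] by blast
    show "openin ?X (T -` U \<inter> topspace ?X)"
      unfolding topspace_graded_kothe
    proof (subst openin_subopen, intro ballI)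
      fix x assume x: "x \<in> T -` U \<inter> ?E"
      \<comment> \<open>The slack between \<open>T x\<close> and the boundary of the target ball, divided by the bound \<open>C\<close>.\<close>
      define \<delta> where "\<delta> = (\<epsilon> - kothe_norm b k (\<lambda>i. T x i - z i)) / C"
      have \<delta>: "0 < \<delta>" using x C by (simp add: \<delta>_def U)
      let ?B = "{y \<in> ?E. kothe_norm a l (\<lambda>i. y i - x i) < \<delta>}"
      have "?B \<subseteq> T -` U \<inter> ?E"
      proof
        fix y assume y: "y \<in> ?B"
        have "kothe_norm b k (\<lambda>i. T y i - T x i) \<le> C * kothe_norm a l (\<lambda>i. y i - x i)"
          using le[OF kothe_space_diff[OF a, of y x]] diff[of y x] x y by simp
        also have "\<dots> < \<epsilon> - kothe_norm b k (\<lambda>i. T x i - z i)"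
          using y C by (simp add: \<delta>_def pos_less_divide_eq mult.commute)
        finally show "y \<in> T -` U \<inter> ?E"
          using kothe_norm_diff_triangle[OF b maps maps z k, of y x] x y by (simp add: U maps)
      qed
      moreover have "x \<in> ?B" using x \<delta> by (simp add: kothe_norm_def)
      ultimately show "\<exists>V. openin ?X V \<and> x \<in> V \<and> V \<subseteq> T -` U \<inter> ?E"
        using openin_graded_ball[of x ?E l \<delta>] x l \<delta> by blast
    qed
  next
    show "T ` topspace ?X \<subseteq> \<Union> {{y \<in> kothe_space b. kothe_norm b k (\<lambda>i. y i - x i) < \<epsilon>} |x k \<epsilon>.
                 x \<in> kothe_space b \<and> 1 \<le> k \<and> 0 < \<epsilon>}"
      unfolding topspace_graded_kothe
      using maps topspace_graded_kothe[of b, unfolded graded_topology_def topology_generated_by_topspace]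
      by blast
  qed
  then show ?thesis
    using maps add scale by (simp add: continuous_linear_ops_def)
qed


section \<open>Stable exponent sequences\<close>

text \<open>The quotients only bound \<open>\<beta>\<^bsub>2n\<^esub>\<close> where \<open>\<beta>\<^sub>n \<noteq> 0\<close>.  Once \<open>\<beta>\<^sub>N > 0\<close>, all zeros of \<open>\<beta>\<close> lie below
  \<open>N\<close>, and \<open>\<beta>\<^bsub>2N\<^esub>\<close> serves as additive constant there.\<close>

lemma stable_seq_doubling_bound:
  fixes \<beta> :: "nat \<Rightarrow> real"
  assumes nonneg: "\<forall>n\<ge>1. 0 \<le> \<beta> n" and mono: "mono_on {1..} \<beta>" and stable: "stable_seq \<beta>"
    and lim: "filterlim \<beta> at_top sequentially"
  shows one_le_stability_const: "1 \<le> stability_const \<beta>"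
    and "\<exists>B. \<forall>n\<ge>1. \<beta> (2 * n) \<le> stability_const \<beta> * \<beta> n + B"
proof -
  have ratio: "\<beta> (2 * n) / \<beta> n \<le> stability_const \<beta>" if "1 \<le> n" "\<beta> n \<noteq> 0" for n
    unfolding stability_const_def using that stable
    by (intro cSUP_upper) (auto simp: stable_seq_def)
  obtain N where N: "1 \<le> N" "0 < \<beta> N"
    using eventually_conj[OF eventually_ge_at_top[of 1]
        filterlim_at_top_dense[THEN iffD1, OF lim, rule_format, of 0]]
    by (auto simp: eventually_sequentially)
  have "\<beta> N \<le> \<beta> (2 * N)" using N by (intro mono_onD[OF mono]) auto
  then have "1 \<le> \<beta> (2 * N) / \<beta> N" using N by simp
  also have "\<dots> \<le> stability_const \<beta>" using N by (intro ratio) auto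
  finally show "1 \<le> stability_const \<beta>" .
  have "\<beta> (2 * n) \<le> stability_const \<beta> * \<beta> n + \<beta> (2 * N)" if n: "1 \<le> n" for n
  proof (cases "\<beta> n = 0")
    case True
    then have "\<not> N \<le> n" using N n mono_onD[OF mono, of N n] by auto
    then have "\<beta> (2 * n) \<le> \<beta> (2 * N)" using n by (intro mono_onD[OF mono]) auto
    then show ?thesis using True by simp
  next
    case False
    then have "0 < \<beta> n" using nonneg n by (simp add: order_less_le)
    then have "\<beta> (2 * n) \<le> stability_const \<beta> * \<beta> n"
      using ratio[OF n False] by (simp add: pos_divide_le_eq)
    moreover have "0 \<le> \<beta> (2 * N)" using nonneg N by simp
    ultimately show ?thesis by simp
  qed
  then show "\<exists>B. \<forall>n\<ge>1. \<beta> (2 * n) \<le> stability_const \<beta> * \<beta> n + B" by blast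
qed

lemma stable_seq_quasi_subadditive:
  fixes \<beta> :: "nat \<Rightarrow> real"
  assumes nonneg: "\<forall>n\<ge>1. 0 \<le> \<beta> n" and mono: "mono_on {1..} \<beta>" and stable: "stable_seq \<beta>"
    and lim: "filterlim \<beta> at_top sequentially"
  shows "\<exists>B. \<forall>n\<ge>1. \<forall>m\<ge>1. \<beta> (n + m - 1) \<le> stability_const \<beta> * (\<beta> n + \<beta> m) + B"
proof -
  let ?M = "stability_const \<beta>"
  obtain B where B: "\<And>n. 1 \<le> n \<Longrightarrow> \<beta> (2 * n) \<le> ?M * \<beta> n + B"
    using stable_seq_doubling_bound(2)[OF assms] by blast
  have M: "0 \<le> ?M" using one_le_stability_const[OF assms] by simp
  have "\<beta> (n + m - 1) \<le> ?M * (\<beta> n + \<beta> m) + B" if nm: "1 \<le> n" "1 \<le> m" for n m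
  proof -
    have "\<beta> (n + m - 1) \<le> \<beta> (2 * max n m)" using nm by (intro mono_onD[OF mono]) auto
    also have "\<dots> \<le> ?M * \<beta> (max n m) + B" using nm by (intro B) auto
    also have "\<beta> (max n m) \<le> \<beta> n + \<beta> m" using nm nonneg by (auto simp: max_def)
    finally show ?thesis using M by (simp add: mult_left_mono)
  qed
  then show ?thesis by blast
qed

text \<open>This is where the index \<open>k\<close> gets stretched by the stability constant.\<close>

lemma power_matrix_quasi_submultiplicative:
  fixes \<beta> :: "nat \<Rightarrow> real"
  assumes "\<forall>n\<ge>1. 0 \<le> \<beta> n" "mono_on {1..} \<beta>" "stable_seq \<beta>" "filterlim \<beta> at_top sequentially"
  shows "\<exists>D>0. \<forall>n\<ge>1. \<forall>m\<ge>1. power_matrix \<beta> (n + m - 1) k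
           \<le> D * (power_matrix \<beta> n (nat \<lceil>stability_const \<beta> * real k\<rceil>)
                 * power_matrix \<beta> m (nat \<lceil>stability_const \<beta> * real k\<rceil>))"
proof -
  let ?M = "stability_const \<beta>"
  let ?l = "nat \<lceil>?M * real k\<rceil>"
  obtain B where B: "\<And>n m. 1 \<le> n \<Longrightarrow> 1 \<le> m \<Longrightarrow> \<beta> (n + m - 1) \<le> ?M * (\<beta> n + \<beta> m) + B"
    using stable_seq_quasi_subadditive[OF assms] by blast
  have "real k * \<beta> (n + m - 1) \<le> real k * B + (real ?l * \<beta> n + real ?l * \<beta> m)"
    if nm: "1 \<le> n" "1 \<le> m" for n m
  proof -
    have "real k * \<beta> (n + m - 1) \<le> real k * (?M * (\<beta> n + \<beta> m) + B)"
      using B[OF nm] by (intro mult_left_mono) auto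
    also have "\<dots> = (?M * real k) * (\<beta> n + \<beta> m) + real k * B" by (simp add: algebra_simps)
    also have "\<dots> \<le> real ?l * (\<beta> n + \<beta> m) + real k * B"
      using nm assms(1) by (intro add_right_mono mult_right_mono real_nat_ceiling_ge add_nonneg_nonneg) auto
    finally show ?thesis by (simp add: algebra_simps)
  qed
  then show ?thesis
    unfolding power_matrix_def
    by (intro exI[of _ "exp (real k * B)"]) (simp add: exp_add[symmetric])
qed


lemma one_le_stretched_index:
  assumes M: "1 \<le> M" and k: "1 \<le> k"
  shows "1 \<le> nat \<lceil>M * real k\<rceil>"
proof -
  have "1 \<le> M * real k" using mult_mono[OF M, of 1 "real k"] M k by simp
  then show ?thesis by linarith
qed

lemma nondecreasing_stretched_index_map:
  assumes S: "nondecreasing_index_map S" and M: "1 \<le> stability_const \<beta>"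
  shows "nondecreasing_index_map (stretched_index_map \<beta> S)"
proof -
  let ?l = "\<lambda>k::nat. nat \<lceil>stability_const \<beta> * real k\<rceil>"
  have "?l j \<le> ?l k" if "j \<le> k" for j k
    using M that by (intro nat_mono ceiling_mono mult_left_mono) auto
  then show ?thesis
    using S one_le_stretched_index[OF M]
    unfolding nondecreasing_index_map_def stretched_index_map_def
    by (auto intro!: mono_onI elim!: mono_onD)
qed


section \<open>Lower triangular Toeplitz operators as convolutions\<close>

definition toeplitz_conv :: "(nat \<Rightarrow> 'a::{real_normed_field,banach}) \<Rightarrow> (nat \<Rightarrow> 'a) \<Rightarrow> nat \<Rightarrow> 'a" where
  "toeplitz_conv \<theta> x = (\<lambda>i. \<Sum>n=1..i. x n * \<theta> (i - n))"

lemma toeplitz_conv_add: "toeplitz_conv \<theta> (\<lambda>i. x i + y i) = (\<lambda>i. toeplitz_conv \<theta> x i + toeplitz_conv \<theta> y i)"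
  by (simp add: toeplitz_conv_def distrib_right sum.distrib)

lemma toeplitz_conv_diff: "toeplitz_conv \<theta> (\<lambda>i. x i - y i) = (\<lambda>i. toeplitz_conv \<theta> x i - toeplitz_conv \<theta> y i)"
  by (simp add: toeplitz_conv_def left_diff_distrib sum_subtractf)

lemma toeplitz_conv_scale: "toeplitz_conv \<theta> (\<lambda>i. c * x i) = (\<lambda>i. c * toeplitz_conv \<theta> x i)"
  by (simp add: toeplitz_conv_def sum_distrib_left mult.assoc)

text \<open>The pairs \<open>(n, i - n + 1)\<close> on the left are distinct and all lie in the square
  \<open>{1..N} \<times> {1..N}\<close>.\<close>

lemma sum_convolution_le:
  fixes u v :: "nat \<Rightarrow> real"
  assumes u: "\<And>n. 1 \<le> n \<Longrightarrow> 0 \<le> u n" and v: "\<And>n. 1 \<le> n \<Longrightarrow> 0 \<le> v n"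
  shows "(\<Sum>i=1..N. \<Sum>n=1..i. u n * v (i - n + 1)) \<le> sum u {1..N} * sum v {1..N}"
proof -
  have "(\<Sum>i=1..N. \<Sum>n=1..i. u n * v (i - n + 1))
      = (\<Sum>(i,n)\<in>(SIGMA i:{1..N}. {1..i}). u n * v (i - n + 1))"
    by (simp add: sum.Sigma)
  also have "\<dots> = (\<Sum>(n,m)\<in>(\<lambda>(i,n). (n, i - n + 1)) ` (SIGMA i:{1..N}. {1..i}). u n * v m)"
    by (subst sum.reindex) (auto simp: inj_on_def o_def case_prod_unfold)
  also have "\<dots> \<le> (\<Sum>(n,m)\<in>{1..N} \<times> {1..N}. u n * v m)"
    by (rule sum_mono2) (auto intro!: mult_nonneg_nonneg u v)
  also have "\<dots> = sum u {1..N} * sum v {1..N}"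
    by (simp add: sum_product sum.cartesian_product)
  finally show ?thesis .
qed

text \<open>Young's inequality in weighted \<open>\<ell>\<^sub>1\<close>.  The shift in \<open>n + m - 1\<close> comes from regarding the symbol,
  indexed from \<open>0\<close>, as a sequence indexed from \<open>1\<close>.  The terms are non-negative, so it suffices to
  bound all finite partial sums, and these reduce to finite convolutions.\<close>

lemma toeplitz_conv_bound:
  fixes \<theta> x :: "nat \<Rightarrow> 'a::{real_normed_field,banach}"
  assumes a: "\<And>n. 1 \<le> n \<Longrightarrow> 0 \<le> a n" and b: "\<And>n. 1 \<le> n \<Longrightarrow> 0 \<le> b n" and c: "\<And>n. 1 \<le> n \<Longrightarrow> 0 \<le> c n"
    and sub: "\<And>n m. 1 \<le> n \<Longrightarrow> 1 \<le> m \<Longrightarrow> c (n + m - 1) \<le> C * (a n * b m)"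
    and C: "0 \<le> C"
    and x: "(\<lambda>n. norm (x n) * a n) summable_on {1..}"
    and \<theta>: "(\<lambda>n. norm (symbol_seq \<theta> n) * b n) summable_on {1..}"
  shows "(\<lambda>i. norm (toeplitz_conv \<theta> x i) * c i) summable_on {1..}"
    and "(\<Sum>\<^sub>\<infinity>i\<in>{1..}. norm (toeplitz_conv \<theta> x i) * c i)
           \<le> C * ((\<Sum>\<^sub>\<infinity>n\<in>{1..}. norm (x n) * a n) * (\<Sum>\<^sub>\<infinity>n\<in>{1..}. norm (symbol_seq \<theta> n) * b n))"
      (is "_ \<le> ?R")
proof -
  define u where "u n = norm (x n) * a n" for n
  define v where "v n = norm (symbol_seq \<theta> n) * b n" for n
  define f where "f i = norm (toeplitz_conv \<theta> x i) * c i" for i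
  have u: "0 \<le> u n" and v: "0 \<le> v n" and f: "0 \<le> f n" if "1 \<le> n" for n
    using a[OF that] b[OF that] c[OF that] by (simp_all add: u_def v_def f_def)
  have su: "u summable_on {1..}" and sv: "v summable_on {1..}"
    using x \<theta> by (simp_all add: u_def[abs_def] v_def[abs_def])
  have pointwise: "f i \<le> C * (\<Sum>n=1..i. u n * v (i - n + 1))" if "1 \<le> i" for i
  proof -
    have "f i \<le> (\<Sum>n=1..i. norm (x n * \<theta> (i - n))) * c i"
      unfolding f_def toeplitz_conv_def using c[OF that] by (intro mult_right_mono norm_sum)
    also have "\<dots> = (\<Sum>n=1..i. norm (x n) * norm (\<theta> (i - n)) * c (n + (i - n + 1) - 1))"
      by (simp add: sum_distrib_right norm_mult)
    also have "\<dots> \<le> (\<Sum>n=1..i. norm (x n) * norm (\<theta> (i - n)) * (C * (a n * b (i - n + 1))))"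
      by (intro sum_mono mult_left_mono sub) auto
    also have "\<dots> = C * (\<Sum>n=1..i. u n * v (i - n + 1))"
      by (simp add: sum_distrib_left u_def v_def symbol_seq_def mult_ac)
    finally show ?thesis .
  qed
  have finite_bound: "sum f F \<le> ?R" if F: "finite F" "F \<subseteq> {1..}" for F
  proof -
    let ?N = "Max (insert 0 F)"
    have "sum f F \<le> sum f {1..?N}"
      using F f by (intro sum_mono2) auto
    also have "\<dots> \<le> C * (\<Sum>i=1..?N. \<Sum>n=1..i. u n * v (i - n + 1))"
      unfolding sum_distrib_left[of C] by (intro sum_mono pointwise[unfolded sum_distrib_left]) simp
    also have "\<dots> \<le> C * (sum u {1..?N} * sum v {1..?N})"
      by (intro mult_left_mono sum_convolution_le u v C)
    also have "\<dots> \<le> C * (infsum u {1..} * infsum v {1..})"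
      using su sv u v
      by (intro mult_left_mono mult_mono finite_sum_le_infsum C sum_nonneg infsum_nonneg) auto
    finally show ?thesis by (simp add: u_def[abs_def] v_def[abs_def])
  qed
  have sf: "f summable_on {1..}"
    by (rule nonneg_bdd_above_summable_on)
       (use f finite_bound in \<open>auto intro!: bdd_aboveI2[where M="?R"]\<close>)
  then show "(\<lambda>i. norm (toeplitz_conv \<theta> x i) * c i) summable_on {1..}"
    by (simp add: f_def[abs_def])
  have "infsum f {1..} \<le> ?R"
    by (rule infsum_le_finite_sums[OF sf finite_bound])
  then show "(\<Sum>\<^sub>\<infinity>i\<in>{1..}. norm (toeplitz_conv \<theta> x i) * c i) \<le> ?R"
    by (simp add: f_def[abs_def])
qed

lemma toeplitz_conv_tame:
  fixes \<theta> :: "nat \<Rightarrow> 'a::{real_normed_field,banach}"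
  assumes \<beta>: "\<forall>n\<ge>1. 0 \<le> \<beta> n" "mono_on {1..} \<beta>" "stable_seq \<beta>" "filterlim \<beta> at_top sequentially"
    and a: "kothe_matrix a" and S: "nondecreasing_index_map S"
    and dom: "\<forall>k\<ge>1. \<exists>C>0. \<forall>n\<ge>1. exp (real k * \<beta> n) \<le> C * a n (S k)"
    and \<theta>: "symbol_seq \<theta> \<in> Lambda_inf \<beta>" and k: "1 \<le> k"
  shows "1 \<le> stretched_index_map \<beta> S k"
    and "\<exists>C>0. \<forall>x\<in>kothe_space a.
           (\<lambda>i. norm (toeplitz_conv \<theta> x i) * power_matrix \<beta> i k) summable_on {1..} \<and>
           Lambda_norm \<beta> k (toeplitz_conv \<theta> x) \<le> C * kothe_norm a (stretched_index_map \<beta> S k) x"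
proof -
  define l where "l = nat \<lceil>stability_const \<beta> * real k\<rceil>"
  have l: "1 \<le> l"
    unfolding l_def by (rule one_le_stretched_index[OF one_le_stability_const[OF \<beta>] k])
  have Sl: "stretched_index_map \<beta> S k = S l" by (simp add: stretched_index_map_def l_def)
  have S1: "1 \<le> S l" using S l by (simp add: nondecreasing_index_map_def)
  then show "1 \<le> stretched_index_map \<beta> S k" by (simp add: Sl)
  obtain D where D: "0 < D" and subm: "\<And>n m. 1 \<le> n \<Longrightarrow> 1 \<le> m \<Longrightarrow>
      power_matrix \<beta> (n + m - 1) k \<le> D * (power_matrix \<beta> n l * power_matrix \<beta> m l)"
    using power_matrix_quasi_submultiplicative[OF \<beta>, of k] unfolding l_def by blast
  obtain C where C: "0 < C" and le: "\<And>n. 1 \<le> n \<Longrightarrow> power_matrix \<beta> n l \<le> C * a n (S l)"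
    using dom l unfolding power_matrix_def by blast
  have sub: "power_matrix \<beta> (n + m - 1) k \<le> (D * C) * (a n (S l) * power_matrix \<beta> m l)"
    if "1 \<le> n" "1 \<le> m" for n m
  proof -
    have "D * (power_matrix \<beta> n l * power_matrix \<beta> m l) \<le> D * ((C * a n (S l)) * power_matrix \<beta> m l)"
      using D by (intro mult_left_mono mult_right_mono le that) (auto simp: power_matrix_def)
    with subm[OF that] show ?thesis by (simp add: mult_ac)
  qed
  define L where "L = Lambda_norm \<beta> l (symbol_seq \<theta>)"
  have L: "0 \<le> L"
    unfolding L_def Lambda_norm_def
    by (rule kothe_norm_nonneg[OF kothe_matrix_power_matrix[OF \<beta>(1)] l])
  \<comment> \<open>\<open>L + 1\<close> instead of \<open>L\<close> keeps the constant positive when \<open>\<theta> = 0\<close>.\<close>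
  have "(\<lambda>i. norm (toeplitz_conv \<theta> x i) * power_matrix \<beta> i k) summable_on {1..} \<and>
        Lambda_norm \<beta> k (toeplitz_conv \<theta> x) \<le> (D * C * (L + 1)) * kothe_norm a (S l) x"
    if x: "x \<in> kothe_space a" for x
  proof
    note est = toeplitz_conv_bound[where a="\<lambda>n. a n (S l)" and b="\<lambda>n. power_matrix \<beta> n l"
        and c="\<lambda>n. power_matrix \<beta> n k" and C="D * C" and x=x and \<theta>=\<theta>,
        OF kothe_matrix_nonneg[OF a _ S1] _ _ sub _ kothe_space_summable[OF x S1]
          kothe_space_summable[OF \<theta>[unfolded Lambda_inf_def] l]]
    show "(\<lambda>i. norm (toeplitz_conv \<theta> x i) * power_matrix \<beta> i k) summable_on {1..}"
      using D C by (intro est) (auto simp: power_matrix_def)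
    have "Lambda_norm \<beta> k (toeplitz_conv \<theta> x) \<le> (D * C) * (kothe_norm a (S l) x * L)"
      unfolding Lambda_norm_def L_def kothe_norm_def
      using D C by (intro est) (auto simp: power_matrix_def)
    also have "\<dots> \<le> (D * C) * (kothe_norm a (S l) x * (L + 1))"
      using D C kothe_norm_nonneg[OF a S1, of x] by (intro mult_left_mono) auto
    finally show "Lambda_norm \<beta> k (toeplitz_conv \<theta> x) \<le> (D * C * (L + 1)) * kothe_norm a (S l) x"
      by (simp add: mult_ac)
  qed
  moreover have "0 < D * C * (L + 1)" using D C L by simp
  ultimately show "\<exists>C>0. \<forall>x\<in>kothe_space a.
           (\<lambda>i. norm (toeplitz_conv \<theta> x i) * power_matrix \<beta> i k) summable_on {1..} \<and>
           Lambda_norm \<beta> k (toeplitz_conv \<theta> x) \<le> C * kothe_norm a (stretched_index_map \<beta> S k) x"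
    unfolding Sl by blast
qed


section \<open>Identification of the operators and tameness\<close>

text \<open>The partial sums of the column series are the truncations of its sum.\<close>

lemma toeplitz_column_eq:
  fixes \<theta> :: "nat \<Rightarrow> 'a::{real_normed_field,banach}"
  assumes \<beta>: "\<forall>n\<ge>1. 0 \<le> \<beta> n" and n: "1 \<le> n"
    and col: "(\<lambda>i. if n \<le> i then \<theta> (i - n) else 0) \<in> Lambda_inf \<beta>"
  shows "toeplitz_column \<beta> \<theta> n = (\<lambda>i. if n \<le> i then \<theta> (i - n) else 0)" (is "_ = ?c")
proof -
  note b = kothe_matrix_power_matrix[OF \<beta>]
  have "(\<lambda>i. \<Sum>j=n..N. \<theta> (j - n) * unit_seq j i) = truncate_seq N ?c" for N
    by (auto simp: fun_eq_iff truncate_seq_def unit_seq_def if_distrib[where f="\<lambda>t. _ * t"] cong: if_cong)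
  then show ?thesis
    using truncate_seq_in_kothe_space[OF b] truncate_seq_tendsto[OF b] col
    unfolding toeplitz_column_def Lambda_inf_def Lambda_norm_def
    by (intro series_limit_kothe_eqI[OF b]) (simp_all add: fun_eq_iff)
qed

text \<open>The columns lie in the target because they are the images of the unit sequences.  The
  \<open>N\<close>-th partial sum of the operator series is the convolution with a truncation of \<open>x\<close>, so
  a norm estimate for the convolution carries the convergence of truncations over to the series.\<close>

lemma toeplitz_op_eq_conv:
  fixes \<theta> :: "nat \<Rightarrow> 'a::{real_normed_field,banach}"
  assumes \<beta>: "\<forall>n\<ge>1. 0 \<le> \<beta> n" and a: "kothe_matrix a"
    and maps: "\<And>x. x \<in> kothe_space a \<Longrightarrow> toeplitz_conv \<theta> x \<in> Lambda_inf \<beta>"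
    and bound: "\<And>k. 1 \<le> k \<Longrightarrow> \<exists>l\<ge>1. \<exists>C>0. \<forall>x\<in>kothe_space a.
                 Lambda_norm \<beta> k (toeplitz_conv \<theta> x) \<le> C * kothe_norm a l x"
    and x: "x \<in> kothe_space a"
  shows "toeplitz_op \<beta> \<theta> x = toeplitz_conv \<theta> x"
proof -
  note b = kothe_matrix_power_matrix[OF \<beta>]
  have column: "toeplitz_column \<beta> \<theta> n = (\<lambda>i. if n \<le> i then \<theta> (i - n) else 0)" if n: "1 \<le> n" for n
  proof (rule toeplitz_column_eq[OF \<beta> n])
    have "(\<lambda>m. norm (unit_seq n m :: 'a) * a m k) summable_on {1..}" for k
      by (rule summable_on_cong_neutral[THEN iffD1, OF _ _ _ summable_on_finite[of "{n}"]])
         (use n in \<open>auto simp: unit_seq_def\<close>)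
    then have "unit_seq n \<in> (kothe_space a :: (nat \<Rightarrow> 'a) set)"
      using n by (simp add: kothe_space_def unit_seq_def)
    from maps[OF this] show "(\<lambda>i. if n \<le> i then \<theta> (i - n) else 0) \<in> Lambda_inf \<beta>"
      using n by (simp add: toeplitz_conv_def unit_seq_def if_distrib[where f="\<lambda>t. t * _"] cong: if_cong)
  qed
  have partial: "(\<lambda>i. \<Sum>n=1..N. x n * toeplitz_column \<beta> \<theta> n i) = toeplitz_conv \<theta> (truncate_seq N x)" for N
  proof
    fix i
    have "(\<Sum>n=1..N. x n * toeplitz_column \<beta> \<theta> n i) = (\<Sum>n=1..N. if n \<le> i then x n * \<theta> (i - n) else 0)"
      by (rule sum.cong) (auto simp: column)
    also have "\<dots> = (\<Sum>n=1..i. if n \<le> N then x n * \<theta> (i - n) else 0)"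
      by (simp add: sum.If_cases) (rule sum.cong, auto)
    also have "\<dots> = toeplitz_conv \<theta> (truncate_seq N x) i"
      unfolding toeplitz_conv_def truncate_seq_def by (rule sum.cong) auto
    finally show "(\<Sum>n=1..N. x n * toeplitz_column \<beta> \<theta> n i) = toeplitz_conv \<theta> (truncate_seq N x) i" .
  qed
  note trunc = truncate_seq_in_kothe_space[OF a x]
  show ?thesis
    unfolding toeplitz_op_def Lambda_inf_def Lambda_norm_def
  proof (rule series_limit_kothe_eqI[OF b])
    show "(\<lambda>i. \<Sum>n=1..N. x n * toeplitz_column \<beta> \<theta> n i) \<in> kothe_space (power_matrix \<beta>)" for N
      unfolding partial using maps[OF trunc] by (simp add: Lambda_inf_def)
    show "toeplitz_conv \<theta> x \<in> kothe_space (power_matrix \<beta>)"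
      using maps[OF x] by (simp add: Lambda_inf_def)
    fix k :: nat assume k: "1 \<le> k"
    obtain l C where l: "1 \<le> l" and le: "\<And>z. z \<in> kothe_space a \<Longrightarrow>
        Lambda_norm \<beta> k (toeplitz_conv \<theta> z) \<le> C * kothe_norm a l z"
      using bound[OF k] by blast
    have upper: "kothe_norm (power_matrix \<beta>) k (\<lambda>i. toeplitz_conv \<theta> (truncate_seq N x) i - toeplitz_conv \<theta> x i)
            \<le> C * kothe_norm a l (\<lambda>i. truncate_seq N x i - x i)" for N
      using le[OF kothe_space_diff[OF a trunc x]] by (simp add: toeplitz_conv_diff Lambda_norm_def)
    have "(\<lambda>N. kothe_norm (power_matrix \<beta>) k
            (\<lambda>i. toeplitz_conv \<theta> (truncate_seq N x) i - toeplitz_conv \<theta> x i)) \<longlonglongrightarrow> 0"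
    proof (rule tendsto_sandwich[OF always_eventually always_eventually tendsto_const])
      show "(\<lambda>N. C * kothe_norm a l (\<lambda>i. truncate_seq N x i - x i)) \<longlonglongrightarrow> 0"
        using tendsto_mult_left[OF truncate_seq_tendsto[OF a x l], of C] by simp
    qed (use upper kothe_norm_nonneg[OF b k] in auto)
    then show "(\<lambda>N. kothe_norm (power_matrix \<beta>) k
            (\<lambda>i. (\<Sum>n=1..N. x n * toeplitz_column \<beta> \<theta> n i) - toeplitz_conv \<theta> x i)) \<longlonglongrightarrow> 0"
      using partial by (simp add: fun_eq_iff)
  qed
qed

theorem proposition3p8:
  fixes \<beta> :: "nat \<Rightarrow> real" and a :: "nat \<Rightarrow> nat \<Rightarrow> real" and S :: "nat \<Rightarrow> nat"
  assumes "\<forall>n\<ge>1. 0 \<le> \<beta> n"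
    and "mono_on {1..} \<beta>"
    and "stable_seq \<beta>"
    and "filterlim \<beta> at_top sequentially"
    and "kothe_matrix a"
    and "nondecreasing_index_map S"
    and "\<forall>k\<ge>1. \<exists>C>0. \<forall>n\<ge>1. exp (real k * \<beta> n) \<le> C * a n (S k)"
  shows "S_tame (stretched_index_map \<beta> S)
           (kothe_space a) (kothe_norm a)
           (Lambda_inf \<beta>) (Lambda_norm \<beta>)
           (toeplitz_family \<beta> :: ((nat \<Rightarrow> 'a::{real_normed_field,banach}) \<Rightarrow> (nat \<Rightarrow> 'a)) set)"
proof -
  let ?S = "stretched_index_map \<beta> S"
  let ?E = "kothe_space a :: (nat \<Rightarrow> 'a) set"
  note a = assms(5) and b = kothe_matrix_power_matrix[OF assms(1)]
  have "T \<in> continuous_linear_ops ?E (kothe_norm a) (Lambda_inf \<beta>) (Lambda_norm \<beta>) \<and>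
        (\<forall>k\<ge>1. \<exists>C>0. \<forall>x\<in>?E. Lambda_norm \<beta> k (T x) \<le> C * kothe_norm a (?S k) x)"
    if T_in: "T \<in> toeplitz_family \<beta>" for T :: "(nat \<Rightarrow> 'a) \<Rightarrow> nat \<Rightarrow> 'a"
  proof -
    obtain \<theta> where T: "T = toeplitz_op \<beta> \<theta>" and \<theta>: "symbol_seq \<theta> \<in> Lambda_inf \<beta>"
      using T_in by (auto simp: toeplitz_family_def)
    note tame = toeplitz_conv_tame[OF assms \<theta>]
    have maps: "toeplitz_conv \<theta> x \<in> Lambda_inf \<beta>" if "x \<in> ?E" for x
      using tame(2) that by (auto simp: Lambda_inf_def kothe_space_def[of "power_matrix \<beta>"] toeplitz_conv_def)
    have bound: "\<exists>C>0. \<forall>x\<in>?E. Lambda_norm \<beta> k (toeplitz_conv \<theta> x) \<le> C * kothe_norm a (?S k) x"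
      if "1 \<le> k" for k
      using tame(2)[OF that] by blast
    have eq: "T x = toeplitz_conv \<theta> x" if "x \<in> ?E" for x
      unfolding T using toeplitz_op_eq_conv[OF assms(1) a maps _ that] bound tame(1) by blast
    have boundT: "\<exists>C>0. \<forall>x\<in>?E. Lambda_norm \<beta> k (T x) \<le> C * kothe_norm a (?S k) x" if "1 \<le> k" for k
      using bound[OF that] by (simp add: eq)
    have "T \<in> continuous_linear_ops ?E (kothe_norm a) (Lambda_inf \<beta>) (Lambda_norm \<beta>)"
      unfolding Lambda_inf_def Lambda_norm_def
    proof (rule continuous_linear_opI[OF a b])
      fix x y :: "nat \<Rightarrow> 'a" and c :: 'a assume x: "x \<in> ?E"
      show "T x \<in> kothe_space (power_matrix \<beta>)"
        using maps[OF x] by (simp add: eq[OF x] Lambda_inf_def)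
      show "T (\<lambda>i. x i + y i) = (\<lambda>i. T x i + T y i)" if y: "y \<in> ?E"
        by (simp add: eq x y kothe_space_add[OF a] toeplitz_conv_add)
      have "(\<lambda>i. c * x i) \<in> ?E"
        using x by (simp add: kothe_space_def norm_mult mult.assoc summable_on_cmult_right)
      then show "T (\<lambda>i. c * x i) = (\<lambda>i. c * T x i)"
        by (simp add: eq x toeplitz_conv_scale)
    next
      fix k :: nat assume "1 \<le> k"
      then show "\<exists>l\<ge>1. \<exists>C>0. \<forall>x\<in>?E. kothe_norm (power_matrix \<beta>) k (T x) \<le> C * kothe_norm a l x"
        using boundT tame(1) unfolding Lambda_norm_def by blast
    qed
    with boundT show ?thesis by blast
  qed
  then show ?thesis
    unfolding S_tame_def
    using nondecreasing_stretched_index_map[OF assms(6) one_le_stability_const[OF assms(1-4)]]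
    by blast
qed

end
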